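(* Let $X$ be a Banach space with a family of closed vector subspaces $\{X_\rho\}_{\rho\in\mathcal D}$ and a family of linear maps $\{\pi_\rho\}_{\rho\in\mathcal D}$ such that $\pi_\rho(X)=X_\rho$ for every $\rho\in\mathcal D$ and $\operatorname{Span}\{\bigcup_{\rho\in\mathcal D}X_\rho\}$ is dense in $X$. Let $f$ be a continuously differentiable functional on $X$ satisfying the generalized P.S. condition, and let $c\in\mathbb{R}$ be such that $K_c=\emptyset$. Let $b>0$ and $\varepsilon>0$ be such that $\|f'(x)\|>b$ for every $x\in A(c,\varepsilon)$, where $A(c,\varepsilon)=f^{-1}([c-\varepsilon,c+\varepsilon])$. Then for every $q\in(0,\varepsilon)$ there is a homeomorphism $w$ of $X$ onto $X$ such that (i) $w(x)=x$ for all $x\in X\setminus A(c,\varepsilon)$; (ii) $w\big(f^{-1}((-\infty,c+q])\big)\subset f^{-1}((-\infty,c-q))$.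
   Context: Generalized critical point: $x\in X$ is a generalized critical point of $f$ if there is a sequence $\{x_j\}$ in $X$ (an approximation sequence of $x$) such that $\lim_{j\to\infty}f'(x_j)=0$ and $\lim_{j\to\infty}\|\pi_\rho(x_j-x)\|=0$ for all $\rho\in\mathcal D$. For such $x$, $\bar f(x)$ is the set of all real limits of $\{f(x_j)\}$ over approximation sequences $\{x_j\}$ of $x$ along which $\{f(x_j)\}$ converges. $K$ is the set of all generalized critical points of $f$, and $K_c=\{x\in K: c\in\bar f(x)\}$. Generalized P.S. condition: for every sequence $\{x_j\}$ in $X$ with $\{f(x_j)\}$ bounded and $f'(x_j)\to0$, there exist $x\in X$ and a subsequence $\{x_{j_k}\}$ such that $\lim_{k\to\infty}\|\pi_\rho(x_{j_k}-x)\|=0$ for all $\rho\in\mathcal D$. *)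

theory Defs
  imports "HOL-Analysis.Analysis"
begin

text \<open>The Frechet derivative as an element of the dual space, so that convergence of and bounds on
  derivatives refer to the operator norm. It is meaningful only where \<open>f\<close> is differentiable.\<close>

definition dual_derivative :: "('a::real_normed_vector \<Rightarrow> real) \<Rightarrow> 'a \<Rightarrow> 'a \<Rightarrow>\<^sub>L real" where
  "dual_derivative f x = Blinfun (frechet_derivative f (at x))"

definition C1_functional :: "('a::real_normed_vector \<Rightarrow> real) \<Rightarrow> bool" where
  "C1_functional f \<longleftrightarrow>
     (\<forall>x. f differentiable (at x)) \<and> continuous_on UNIV (dual_derivative f)"

lemma dual_derivative_eqI:
  assumes "(f has_derivative blinfun_apply L) (at x)"
  shows "dual_derivative f x = L"
  using frechet_derivative_at[OF assms]
  by (metis blinfun_apply_inverse dual_derivative_def)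

lemma has_derivative_dual_derivative:
  assumes "f differentiable (at x)"
  shows "(f has_derivative blinfun_apply (dual_derivative f x)) (at x)"
  using assms has_derivative_bounded_linear[of f "frechet_derivative f (at x)" "at x"]
  by (simp add: dual_derivative_def bounded_linear_Blinfun_apply
      frechet_derivative_works[symmetric])

text \<open>In the following, \<open>D\<close> is the index set of the family of linear maps \<open>\<pi> \<rho>\<close>, which need not be
  bounded.\<close>

definition approximation_sequence ::
  "'r set \<Rightarrow> ('r \<Rightarrow> 'a \<Rightarrow> 'a) \<Rightarrow> ('a::real_normed_vector \<Rightarrow> real) \<Rightarrow> 'a \<Rightarrow> (nat \<Rightarrow> 'a) \<Rightarrow> bool" where
  "approximation_sequence D \<pi> f x xs \<longleftrightarrow>
     (\<lambda>j. dual_derivative f (xs j)) \<longlonglongrightarrow> 0 \<and>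
     (\<forall>\<rho>\<in>D. (\<lambda>j. norm (\<pi> \<rho> (xs j - x))) \<longlonglongrightarrow> 0)"

definition generalized_critical_points ::
  "'r set \<Rightarrow> ('r \<Rightarrow> 'a \<Rightarrow> 'a) \<Rightarrow> ('a::real_normed_vector \<Rightarrow> real) \<Rightarrow> 'a set" where
  "generalized_critical_points D \<pi> f = {x. \<exists>xs. approximation_sequence D \<pi> f x xs}"

definition generalized_values ::
  "'r set \<Rightarrow> ('r \<Rightarrow> 'a \<Rightarrow> 'a) \<Rightarrow> ('a::real_normed_vector \<Rightarrow> real) \<Rightarrow> 'a \<Rightarrow> real set" where
  "generalized_values D \<pi> f x =
     {l. \<exists>xs. approximation_sequence D \<pi> f x xs \<and> (\<lambda>j. f (xs j)) \<longlonglongrightarrow> l}"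

definition generalized_critical_points_at ::
  "'r set \<Rightarrow> ('r \<Rightarrow> 'a \<Rightarrow> 'a) \<Rightarrow> ('a::real_normed_vector \<Rightarrow> real) \<Rightarrow> real \<Rightarrow> 'a set" where
  "generalized_critical_points_at D \<pi> f c =
     {x \<in> generalized_critical_points D \<pi> f. c \<in> generalized_values D \<pi> f x}"

definition generalized_PS ::
  "'r set \<Rightarrow> ('r \<Rightarrow> 'a \<Rightarrow> 'a) \<Rightarrow> ('a::real_normed_vector \<Rightarrow> real) \<Rightarrow> bool" where
  "generalized_PS D \<pi> f \<longleftrightarrow>
     (\<forall>xs :: nat \<Rightarrow> 'a.
        bounded (range (\<lambda>j. f (xs j))) \<and> (\<lambda>j. dual_derivative f (xs j)) \<longlonglongrightarrow> 0 \<longrightarrow>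
        (\<exists>x r. strict_mono (r :: nat \<Rightarrow> nat) \<and>
           (\<forall>\<rho>\<in>D. (\<lambda>k. norm (\<pi> \<rho> (xs (r k) - x))) \<longlonglongrightarrow> 0)))"

definition level_band :: "('a \<Rightarrow> real) \<Rightarrow> real \<Rightarrow> real \<Rightarrow> 'a set" where
  "level_band f c \<epsilon> = f -` {c - \<epsilon>..c + \<epsilon>}"

end

theory Submission
  imports Defs
begin

text \<open>A pseudo-gradient field that never vanishes on the band is built with a global Lipschitz constant, at the
  price of having no uniform lower bound on its norm. Its flow therefore cannot be run for a fixed
  time. Instead each point of the band slides along its orbit from level \<open>s\<close> to level \<open>h s\<close>, where \<open>h\<close> is a
  homeomorphism of the interval of levels fixing the endpoints. Orbits do cross the band, since one
  that stays in it has finite length and would converge to a zero of the field.\<close>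

text \<open>A lower bound on the norm of the derivative supplies, near each point of the band, one
  vector along which \<open>f\<close> ascends at rate above \<open>b\<close>. As
  \<open>dual_derivative f\<close> is merely continuous, these vectors must be glued by Lipschitz
  functions, and a field that is only locally Lipschitz would force maximal solutions into the
  argument. What makes it affordable to give up a lower bound on the speed is that
  \<open>norm (N x) \<le> S x\<close> and \<open>b * S x \<le> dual_derivative f x (N x)\<close> are
  unaffected when \<open>N\<close> and \<open>S\<close> are multiplied by the same positive
  function. Together they say that \<open>b\<close> times the speed is at most the rate of ascent,
  an estimate on orbits as curves in which time no longer occurs. Levels of \<open>f\<close>
  therefore replace time as the parameter, and the strict gap \<open>q < \<epsilon>\<close> leaves
  room to push level \<open>c + q\<close> below \<open>c - q\<close> while the ends of the band stay
  fixed.\<close>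

section \<open>Lipschitz bump functions subordinate to an open cover\<close>

text \<open>The device of Stone's paracompactness theorem: well-order the indices and assign each
  point to the first set containing it; the n-th layer keeps the points whose ball of radius
  \<open>(1/2)^n\<close> stays in that set. If \<open>i\<close> precedes \<open>j\<close>, a point
  assigned to \<open>j\<close> lies outside \<open>U i\<close>, hence outside the balls around
  points of \<open>E n i\<close>.\<close>

lemma sigma_discrete_refinement:
  fixes U :: "'i \<Rightarrow> 'a::metric_space set"
  assumes "\<And>i. i \<in> I \<Longrightarrow> open (U i)"
  obtains E :: "nat \<Rightarrow> 'i \<Rightarrow> 'a set" where
    "\<And>n i y. y \<in> E n i \<Longrightarrow> i \<in> I \<and> ball y ((1/2)^n) \<subseteq> U i"
    "\<And>n i j y z. \<lbrakk>y \<in> E n i; z \<in> E n j; i \<noteq> j\<rbrakk> \<Longrightarrow> (1/2)^n \<le> dist y z"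
    "\<And>y i. \<lbrakk>i \<in> I; y \<in> U i\<rbrakk> \<Longrightarrow> \<exists>n j. y \<in> E n j"
proof -
  obtain r :: "'i rel" where r: "well_order_on UNIV r"
    using well_order_on by blast
  define E where "E = (\<lambda>n i. {y. i \<in> I \<and> ball y ((1/2)^n) \<subseteq> U i \<and>
    (\<forall>j\<in>I. y \<in> U j \<longrightarrow> (i, j) \<in> r)})" for n :: nat
  have sep: "(1/2)^n \<le> dist y z" if "y \<in> E n i" "z \<in> E n j" "i \<noteq> j" "(i, j) \<in> r" for n i j y z
  proof (rule ccontr)
    assume "\<not> ?thesis"
    with that(1) have "z \<in> U i" "i \<in> I" by (auto simp: E_def)
    with that(2) have "(j, i) \<in> r" by (auto simp: E_def)
    with that r show False
      by (auto simp: well_order_on_def linear_order_on_def partial_order_on_def antisym_def)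
  qed
  show thesis
  proof
    show "i \<in> I \<and> ball y ((1/2)^n) \<subseteq> U i" if "y \<in> E n i" for n i y
      using that by (auto simp: E_def)
    show "(1/2)^n \<le> dist y z" if "y \<in> E n i" "z \<in> E n j" "i \<noteq> j" for n i j y z
    proof -
      have "(i, j) \<in> r \<or> (j, i) \<in> r"
        using r \<open>i \<noteq> j\<close> by (auto simp: well_order_on_def linear_order_on_def total_on_def)
      then show ?thesis
        using sep that by (metis dist_commute)
    qed
    show "\<exists>n j. y \<in> E n j" if iy: "i \<in> I" "y \<in> U i" for y i
    proof -
      have wf: "wf (r - Id)" using r by (simp add: well_order_on_def)
      obtain k where k: "k \<in> {j \<in> I. y \<in> U j}" and
        kmin: "\<And>j. (j, k) \<in> r - Id \<Longrightarrow> j \<notin> {j \<in> I. y \<in> U j}"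
        using wfE_min[OF wf, of i "{j \<in> I. y \<in> U j}"] iy by blast
      have least: "(k, j) \<in> r" if "j \<in> I" "y \<in> U j" for j
      proof (cases "j = k")
        case True
        then show ?thesis using r
          by (auto simp: well_order_on_def linear_order_on_def partial_order_on_def
              preorder_on_def refl_on_def)
      next
        case False
        then show ?thesis using r kmin[of j] that
          by (auto simp: well_order_on_def linear_order_on_def total_on_def)
      qed
      obtain e where e: "e > 0" "ball y e \<subseteq> U k"
        using assms[of k] k by (auto simp: open_contains_ball)
      obtain n where "(1/2::real)^n < e"
        using real_arch_pow_inv[OF e(1), of "1/2"] by auto
      then have "ball y ((1/2)^n) \<subseteq> U k"
        using e(2) by (meson less_le order_trans subset_ball)
      then have "y \<in> E n k"
        using k least by (auto simp: E_def)
      then show ?thesis by blast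
    qed
  qed
qed

text \<open>Cutting off the distance to \<open>E n i\<close> at half the separation radius makes the
  supports within a layer disjoint. The bumps are left unscaled, so their Lipschitz constant is 1
  for every \<open>n\<close> and \<open>i\<close>; only their positivity is needed later.\<close>

lemma sigma_discrete_bump_functions:
  fixes U :: "'i \<Rightarrow> 'a::metric_space set"
  assumes "\<And>i. i \<in> I \<Longrightarrow> open (U i)"
  obtains \<psi> :: "nat \<Rightarrow> 'i \<Rightarrow> 'a \<Rightarrow> real" where
    "\<And>n i y. 0 \<le> \<psi> n i y" "\<And>n i y. \<psi> n i y \<le> 1"
    "\<And>n i y z. \<bar>\<psi> n i y - \<psi> n i z\<bar> \<le> dist y z"
    "\<And>n i y. 0 < \<psi> n i y \<Longrightarrow> i \<in> I \<and> y \<in> U i"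
    "\<And>n i j y. \<lbrakk>0 < \<psi> n i y; 0 < \<psi> n j y\<rbrakk> \<Longrightarrow> i = j"
    "\<And>y i. \<lbrakk>i \<in> I; y \<in> U i\<rbrakk> \<Longrightarrow> \<exists>n j. 0 < \<psi> n j y"
proof -
  obtain E :: "nat \<Rightarrow> 'i \<Rightarrow> 'a set" where
    E: "\<And>n i y. y \<in> E n i \<Longrightarrow> i \<in> I \<and> ball y ((1/2)^n) \<subseteq> U i"
    and sep: "\<And>n i j y z. \<lbrakk>y \<in> E n i; z \<in> E n j; i \<noteq> j\<rbrakk> \<Longrightarrow> (1/2)^n \<le> dist y z"
    and cov: "\<And>y i. \<lbrakk>i \<in> I; y \<in> U i\<rbrakk> \<Longrightarrow> \<exists>n j. y \<in> E n j"
    using sigma_discrete_refinement[of I U] assms by metis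
  \<comment> \<open>\<open>infdist\<close> to the empty set is 0, so without the case distinction an
    empty \<open>E n i\<close> would yield a positive constant.\<close>
  define \<psi> where "\<psi> = (\<lambda>n i y. if E n i = {} then 0 else max 0 ((1/2)^n / 2 - infdist y (E n i)))"
  have near: "\<exists>z\<in>E n i. dist y z < (1/2)^n / 2" if "0 < \<psi> n i y" for n i y
  proof -
    have "E n i \<noteq> {}" "infdist y (E n i) < (1/2)^n / 2"
      using that by (auto simp: \<psi>_def split: if_splits)
    then show ?thesis
      using cInf_lessD[of "dist y ` E n i" "(1/2)^n / 2"] by (auto simp: infdist_notempty)
  qed
  show thesis
  proof
    show "0 \<le> \<psi> n i y" for n i y by (simp add: \<psi>_def)
    show "\<psi> n i y \<le> 1" for n i y
    proof -
      have "(1/2::real)^n \<le> 1" by (simp add: power_le_one)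
      then have "(1/2)^n / 2 - infdist y (E n i) \<le> 1"
        using infdist_nonneg[of y "E n i"] by linarith
      then show ?thesis by (simp add: \<psi>_def)
    qed
    show "\<bar>\<psi> n i y - \<psi> n i z\<bar> \<le> dist y z" for n i y z
      using infdist_triangle_abs[of y "E n i" z] by (auto simp: \<psi>_def)
    show "i \<in> I \<and> y \<in> U i" if "0 < \<psi> n i y" for n i y
    proof -
      obtain z where "z \<in> E n i" "dist y z < (1/2)^n / 2"
        using near \<open>0 < \<psi> n i y\<close> by blast
      moreover have "(1/2::real)^n / 2 < (1/2)^n" by simp
      ultimately have "y \<in> ball z ((1/2)^n)" unfolding mem_ball by (metis dist_commute order_less_trans)
      then show ?thesis using E[OF \<open>z \<in> E n i\<close>] by blast
    qed
    show "i = j" if "0 < \<psi> n i y" "0 < \<psi> n j y" for n i j y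
    proof (rule ccontr)
      assume "i \<noteq> j"
      obtain z z' where z: "z \<in> E n i" "dist y z < (1/2)^n / 2" "z' \<in> E n j" "dist y z' < (1/2)^n / 2"
        using near[OF \<open>0 < \<psi> n i y\<close>] near[OF \<open>0 < \<psi> n j y\<close>] by blast
      then have "dist z z' < (1/2)^n"
        using dist_triangle_half_r by blast
      with sep[OF z(1,3) \<open>i \<noteq> j\<close>] show False by simp
    qed
    show "\<exists>n j. 0 < \<psi> n j y" if iy: "i \<in> I" "y \<in> U i" for y i
    proof -
      obtain n j where "y \<in> E n j" using cov iy by blast
      then have "0 < \<psi> n j y" by (auto simp: \<psi>_def)
      then show ?thesis by blast
    qed
  qed
qed

section \<open>A globally Lipschitz pseudo-gradient field\<close>

lemma norm_blinfun_gtE: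
  fixes L :: "'a::real_normed_vector \<Rightarrow>\<^sub>L real"
  assumes "b < norm L" "0 \<le> b"
  obtains v where "norm v \<le> 1" "b < L v"
proof -
  have "\<exists>v. norm v \<le> 1 \<and> b < L v"
  proof (rule ccontr)
    assume "\<not> ?thesis"
    then have le: "L v \<le> b" if "norm v \<le> 1" for v
      using that by (meson not_le)
    have "norm (L x) \<le> b * norm x" for x
    proof (cases "x = 0")
      case False
      have "L ((1 / norm x) *\<^sub>R x) \<le> b" "L (- ((1 / norm x) *\<^sub>R x)) \<le> b"
        using False by (auto intro!: le)
      then show ?thesis using False
        by (auto simp: blinfun.scaleR_right blinfun.minus_right field_simps abs_le_iff)
    qed simp
    then have "norm L \<le> b"
      using assms(2) norm_blinfun_bound by blast
    with assms(1) show False by simp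
  qed
  with that show thesis by blast
qed

text \<open>Normalising \<open>N\<close> by \<open>S\<close> would give a pseudo-gradient of norm at most one that is only locally
  Lipschitz. The unnormalised sum is globally Lipschitz, because the \<open>n\<close>-th layer of bumps is
  disjointly supported and carries the weight \<open>2\<^sup>-\<^sup>n\<close>.\<close>

lemma lipschitz_pseudo_gradient:
  fixes G :: "'a::banach \<Rightarrow> 'a \<Rightarrow>\<^sub>L real"
  assumes G: "continuous_on UNIV G" and "0 \<le> b" and \<Omega>: "\<And>x. x \<in> \<Omega> \<Longrightarrow> b < norm (G x)"
  obtains N :: "'a \<Rightarrow> 'a" and S :: "'a \<Rightarrow> real" where
    "\<And>x y. norm (N x - N y) \<le> 4 * norm (x - y)"
    "\<And>x. norm (N x) \<le> S x" "\<And>x. S x \<le> 2" "continuous_on UNIV S"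
    "\<And>x. b * S x \<le> G x (N x)"
    "\<And>x. x \<in> \<Omega> \<Longrightarrow> 0 < S x"
proof -
  \<comment> \<open>The cover is indexed by the directions themselves, so the index of a bump is the
    vector that it contributes to the field.\<close>
  define U where "U v = {x. b < G x v}" for v
  have "continuous_on UNIV (\<lambda>x. G x v)" for v
    using G by (intro continuous_intros)
  then have oU: "open (U v)" for v
    unfolding U_def by (intro open_Collect_less continuous_on_const)
  define I where "I = {v::'a. norm v \<le> 1}"
  obtain \<psi> :: "nat \<Rightarrow> 'a \<Rightarrow> 'a \<Rightarrow> real" where
    \<psi>0: "\<And>n i y. 0 \<le> \<psi> n i y" and \<psi>1: "\<And>n i y. \<psi> n i y \<le> 1"
    and lip: "\<And>n i y z. \<bar>\<psi> n i y - \<psi> n i z\<bar> \<le> dist y z"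
    and supp: "\<And>n i y. 0 < \<psi> n i y \<Longrightarrow> i \<in> I \<and> y \<in> U i"
    and disj: "\<And>n i j y. \<lbrakk>0 < \<psi> n i y; 0 < \<psi> n j y\<rbrakk> \<Longrightarrow> i = j"
    and cov: "\<And>y i. \<lbrakk>i \<in> I; y \<in> U i\<rbrakk> \<Longrightarrow> \<exists>n j. 0 < \<psi> n j y"
    using sigma_discrete_bump_functions[of I U] oU by metis
  \<comment> \<open>At most one index is active at \<open>y\<close> in layer \<open>n\<close>. If
    none is, the choice is arbitrary, possibly outside the unit ball, but then
    \<open>\<sigma> n y = 0\<close>.\<close>
  define v where "v n y = (SOME i. 0 < \<psi> n i y)" for n y
  have v: "v n y = i" if "0 < \<psi> n i y" for n y i
    unfolding v_def using that disj by (metis (mono_tags, lifting) someI)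
  define \<sigma> where "\<sigma> n y = \<psi> n (v n y) y" for n y
  define T where "T n y = \<sigma> n y *\<^sub>R v n y" for n y
  have v1: "norm (v n y) \<le> 1" if "0 < \<sigma> n y" for n y
    using supp that by (auto simp: \<sigma>_def I_def)
  have \<sigma>01: "0 \<le> \<sigma> n y" "\<sigma> n y \<le> 1" for n y
    by (simp_all add: \<sigma>_def \<psi>0 \<psi>1)
  have T\<sigma>: "norm (T n y) \<le> \<sigma> n y" for n y
    using v1[of n y] \<sigma>01[of n y] by (cases "\<sigma> n y = 0") (auto simp: T_def mult_left_le)
  \<comment> \<open>The bump active at \<open>y\<close> vanishes at \<open>z\<close>, so its height
    at \<open>y\<close> is at most the distance.\<close>
  have cross: "\<sigma> n y \<le> dist y z" if "v n y \<noteq> v n z" for n y z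
  proof -
    have "\<psi> n (v n y) z = 0"
      using v[of n "v n y" z] \<psi>0[of n "v n y" z] that by (metis less_eq_real_def)
    then show ?thesis
      using lip[of n "v n y" y z] by (simp add: \<sigma>_def)
  qed
  have same: "\<bar>\<sigma> n y - \<sigma> n z\<bar> \<le> dist y z" if "v n y = v n z" for n y z
    using that lip by (simp add: \<sigma>_def)
  have \<sigma>_lip: "\<bar>\<sigma> n y - \<sigma> n z\<bar> \<le> 2 * dist y z" for n y z
    using same[of n y z] cross[of n y z] cross[of n z y] \<sigma>01(1)[of n y] \<sigma>01(1)[of n z]
      zero_le_dist[of y z] dist_commute[of y z] by fastforce
  \<comment> \<open>If the chosen vectors agree but neither weight is positive, the vector has no
    norm bound. That case joins the one of different vectors, where each term is bounded separately;
    this is the origin of the factor 2.\<close>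
  have T_lip: "norm (T n y - T n z) \<le> 2 * dist y z" for n y z
  proof (cases "v n y = v n z \<and> (0 < \<sigma> n y \<or> 0 < \<sigma> n z)")
    case True
    then have "norm (v n y) \<le> 1" using v1 by metis
    moreover have "T n y - T n z = (\<sigma> n y - \<sigma> n z) *\<^sub>R v n y"
      using True by (simp add: T_def scaleR_diff_left)
    ultimately have "norm (T n y - T n z) \<le> \<bar>\<sigma> n y - \<sigma> n z\<bar>"
      by (simp add: mult_left_le)
    then show ?thesis using same[of n y z] True zero_le_dist[of y z] by linarith
  next
    case False
    then have "\<sigma> n y \<le> dist y z" "\<sigma> n z \<le> dist y z"
      using cross[of n y z] cross[of n z y] zero_le_dist[of y z] \<sigma>01(1)[of n y] \<sigma>01(1)[of n z]
      by (auto simp: dist_commute intro: order_trans)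
    then show ?thesis
      using norm_triangle_ineq4[of "T n y" "T n z"] T\<sigma>[of n y] T\<sigma>[of n z] by linarith
  qed
  have geo: "summable (\<lambda>n. C * (1/2::real)^n)" "(\<Sum>n. C * (1/2::real)^n) = 2 * C" for C
    using sums_mult[OF geometric_sums[of "1/2::real"], of C]
    by (auto simp: sums_iff)
  have sumT: "summable (\<lambda>n. (1/2)^n *\<^sub>R T n y)" for y
  proof (rule summable_comparison_test')
    show "summable (\<lambda>n. 1 * (1/2::real)^n)" by (rule geo)
    show "norm ((1/2)^n *\<^sub>R T n y) \<le> 1 * (1/2)^n" for n
      using order_trans[OF T\<sigma>[of n y] \<sigma>01(2)] by (simp add: field_simps)
  qed
  have sum\<sigma>: "summable (\<lambda>n. (1/2)^n * \<sigma> n y)" for y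
  proof (rule summable_comparison_test')
    show "summable (\<lambda>n. 1 * (1/2::real)^n)" by (rule geo)
    show "norm ((1/2)^n * \<sigma> n y) \<le> 1 * (1/2)^n" for n
      using \<sigma>01[of n y] by (simp add: field_simps)
  qed
  define N where "N y = (\<Sum>n. (1/2)^n *\<^sub>R T n y)" for y
  define S where "S y = (\<Sum>n. (1/2)^n * \<sigma> n y)" for y
  \<comment> \<open>Here, and for \<open>N\<close> below, 4 is the constant 2 of a layer times the
    sum 2 of the weights.\<close>
  have S_lip: "norm (S y - S z) \<le> 4 * dist y z" for y z
  proof -
    have "S y - S z = (\<Sum>n. (1/2)^n * (\<sigma> n y - \<sigma> n z))"
      unfolding S_def by (subst suminf_diff[OF sum\<sigma> sum\<sigma>]) (simp add: algebra_simps)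
    moreover have "norm (\<Sum>n. (1/2)^n * (\<sigma> n y - \<sigma> n z)) \<le> (\<Sum>n. (2 * dist y z) * (1/2)^n)"
      using \<sigma>_lip[of _ y z] by (intro norm_suminf_le geo) (simp add: abs_mult field_simps)
    ultimately show ?thesis by (simp add: geo)
  qed
  show thesis
  proof
    show "norm (N y - N z) \<le> 4 * norm (y - z)" for y z
    proof -
      have "N y - N z = (\<Sum>n. (1/2)^n *\<^sub>R (T n y - T n z))"
        unfolding N_def by (subst suminf_diff[OF sumT sumT]) (simp add: algebra_simps)
      moreover have "norm (\<Sum>n. (1/2)^n *\<^sub>R (T n y - T n z)) \<le> (\<Sum>n. (2 * dist y z) * (1/2)^n)"
        using T_lip[of _ y z] by (intro norm_suminf_le geo) (simp add: divide_right_mono power_one_over)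
      ultimately show ?thesis by (simp add: geo dist_norm)
    qed
    show "norm (N y) \<le> S y" for y
      unfolding N_def S_def
      by (intro norm_suminf_le sum\<sigma>) (simp add: T\<sigma> mult_left_mono)
    show "S y \<le> 2" for y
    proof -
      have "S y \<le> (\<Sum>n. 1 * (1/2)^n)"
        unfolding S_def using \<sigma>01 by (intro suminf_le sum\<sigma> geo) (simp add: field_simps)
      then show ?thesis by (simp only: geo)
    qed
    show "continuous_on UNIV S"
      using S_lip by (intro lipschitz_on_continuous_on[of 4] lipschitz_onI) (auto simp: dist_norm)
    show "b * S y \<le> G y (N y)" for y
    proof -
      have "G y (N y) = (\<Sum>n. G y ((1/2)^n *\<^sub>R T n y))"
        unfolding N_def using bounded_linear.suminf[OF blinfun.bounded_linear_right sumT]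
        by metis
      moreover have "summable (\<lambda>n. G y ((1/2)^n *\<^sub>R T n y))"
        by (intro bounded_linear.summable[OF blinfun.bounded_linear_right sumT])
      moreover have "b * ((1/2)^n * \<sigma> n y) \<le> G y ((1/2)^n *\<^sub>R T n y)" for n
      proof (cases "\<sigma> n y = 0")
        case False
        then have "0 < \<psi> n (v n y) y" using \<sigma>01(1)[of n y] by (simp add: \<sigma>_def)
        then have "b < G y (v n y)" using supp by (auto simp: U_def)
        then have "\<sigma> n y * b \<le> \<sigma> n y * G y (v n y)" using \<sigma>01(1) by (intro mult_left_mono) auto
        then show ?thesis by (simp add: T_def blinfun.scaleR_right field_simps)
      qed (simp add: T_def blinfun.zero_right)
      ultimately show ?thesis
        unfolding S_def by (simp add: suminf_mult[OF sum\<sigma>, symmetric] suminf_le sum\<sigma> summable_mult)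
    qed
    show "0 < S y" if "y \<in> \<Omega>" for y
    proof -
      obtain u where "norm u \<le> 1" "b < G y u"
        using norm_blinfun_gtE[OF \<Omega>[OF \<open>y \<in> \<Omega>\<close>] \<open>0 \<le> b\<close>] by blast
      then obtain n j where nj: "0 < \<psi> n j y"
        using cov[of u y] unfolding I_def U_def by blast
      then have "0 < \<sigma> n y" using v by (auto simp: \<sigma>_def)
      then show ?thesis
        unfolding S_def using \<sigma>01(1) by (intro suminf_pos2[OF sum\<sigma>, of _ n]) auto
    qed
  qed
qed

section \<open>The global flow of a bounded Lipschitz field\<close>

text \<open>Integrating the exponential weight of rate \<open>K\<close> gains a factor
  \<open>1 / K\<close>. With \<open>K = 2 * L\<close> this beats the Lipschitz constant
  \<open>L\<close> of a field by a factor 2, which drives both the uniqueness and the existence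
  proof.\<close>

lemma norm_le_exp_of_derivative_le:
  fixes h :: "real \<Rightarrow> 'a::real_normed_vector"
  assumes h: "\<And>t. (h has_vector_derivative g t) (at t)"
    and g: "\<And>t. norm (g t) \<le> C * K * exp (K * \<bar>t\<bar>)"
  shows "norm (h t - h 0) \<le> C * (exp (K * \<bar>t\<bar>) - 1)"
proof -
  have pos: "norm (h t - h 0) \<le> C * (exp (K * t) - 1)"
    if h: "\<And>t. (h has_vector_derivative g t) (at t)"
    and g: "\<And>t. norm (g t) \<le> C * K * exp (K * \<bar>t\<bar>)" and "0 < t"
    for h g :: "real \<Rightarrow> 'a" and t
  proof -
    have "norm (h t - h 0) \<le> C * exp (K * t) - C * exp (K * 0)"
    proof (rule differentiable_bound_general[OF \<open>0 < t\<close>])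
      show "continuous_on {0..t} h"
        using h by (meson continuous_at_imp_continuous_on has_vector_derivative_continuous)
      show "((\<lambda>t. C * exp (K * t)) has_vector_derivative C * (exp (K * s) * K)) (at s)" for s
        unfolding has_real_derivative_iff_has_vector_derivative[symmetric]
        by (auto intro!: derivative_eq_intros)
      show "norm (g s) \<le> C * (exp (K * s) * K)" if "0 < s" for s
        using g[of s] that by (simp add: mult_ac)
    qed (auto intro!: continuous_intros h)
    then show ?thesis by (simp add: algebra_simps)
  qed
  have neg: "((\<lambda>t. h (- t)) has_vector_derivative - g (- s)) (at s)" for s
  proof -
    have "(uminus has_vector_derivative (-1::real)) (at s)"
      by (auto intro!: derivative_eq_intros)
    from vector_diff_chain_at[OF this h] show ?thesis by (simp add: o_def)
  qed
  have "norm (- g (- s)) \<le> C * K * exp (K * \<bar>s\<bar>)" for s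
    using g[of "- s"] by simp
  from pos[OF neg this, of "- t"] pos[OF h g, of t] show ?thesis
    by (cases "t = 0"; cases "0 < t") simp_all
qed

lemma antiderivative_on_reals:
  fixes g :: "real \<Rightarrow> 'a::banach"
  assumes "continuous_on UNIV g"
  obtains h where "\<And>t. (h has_vector_derivative g t) (at t)" "h 0 = 0"
proof -
  \<comment> \<open>An integral over a reversed interval is 0, so for \<open>t\<close> other than 0
    only one of the two terms is over a nonempty interval.\<close>
  define h where "h = (\<lambda>t. integral {0..t} g - integral {t..0} g)"
  have "h 0 = 0" by (simp add: h_def)
  moreover have "(h has_vector_derivative g t) (at t)" for t
  proof -
    \<comment> \<open>Both 0 and \<open>t\<close> lie strictly inside \<open>{-R..R}\<close>, where
      \<open>h\<close> is, up to a constant, a single integral from a fixed endpoint.\<close>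
    define R where "R = \<bar>t\<bar> + 1"
    have cont: "continuous_on A g" for A
      using assms continuous_on_subset by blast
    have int: "g integrable_on {a..b}" for a b
      by (intro integrable_continuous_real cont)
    have eq: "h s = integral {-R..s} g - integral {-R..0} g" if "s \<in> {-R<..<R}" for s
    proof (cases "0 \<le> s")
      case True
      then show ?thesis using Henstock_Kurzweil_Integration.integral_combine[OF _ True int, of "-R"] that
        by (cases "s = 0") (auto simp: h_def R_def algebra_simps)
    next
      case False
      then show ?thesis using Henstock_Kurzweil_Integration.integral_combine[of "-R" s 0, OF _ _ int] that
        by (auto simp: h_def algebra_simps)
    qed
    have t: "t \<in> {-R<..<R}" by (auto simp: R_def)
    have "((\<lambda>u. integral {-R..u} g) has_vector_derivative g t) (at t within {-R..R})"
      using t by (intro integral_has_vector_derivative cont) auto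
    then have "((\<lambda>u. integral {-R..u} g) has_vector_derivative g t) (at t)"
      using t at_within_interior[of t "{-R..R}"] by (simp add: interior_atLeastAtMost_real)
    then have "((\<lambda>u. integral {-R..u} g - integral {-R..0} g) has_vector_derivative g t) (at t)"
      by (simp add: has_vector_derivative_diff_const)
    then show ?thesis
      by (rule has_vector_derivative_transform_within_open[of _ _ _ "{-R<..<R}"])
         (use t eq in auto)
  qed
  ultimately show thesis using that by blast
qed

text \<open>Gronwall's estimate by iteration. If the difference is at most \<open>B\<close> times
  the weight, the Lipschitz bound and one integration improve \<open>B\<close> to
  \<open>d + B / 2\<close>; the fixed point of this map is \<open>2 * d\<close>. Boundedness of
  \<open>F\<close> supplies the first \<open>B\<close>.\<close>

lemma ode_solutions_dist:
  fixes F :: "'a::real_normed_vector \<Rightarrow> 'a"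
  assumes lip: "\<And>x y. norm (F x - F y) \<le> L * norm (x - y)" and "L > 0"
    and bnd: "\<And>x. norm (F x) \<le> M"
    and y: "\<And>t. (y has_vector_derivative F (y t)) (at t)"
    and z: "\<And>t. (z has_vector_derivative F (z t)) (at t)"
  shows "norm (y t - z t) \<le> 2 * exp (2 * L * \<bar>t\<bar>) * norm (y 0 - z 0)"
proof -
  define d where "d = norm (y 0 - z 0)"
  have deriv: "((\<lambda>t. y t - z t) has_vector_derivative (F (y t) - F (z t))) (at t)" for t
    by (intro has_vector_derivative_diff y z)
  have M: "0 \<le> M" using order_trans[OF norm_ge_zero bnd] .
  have E1: "1 \<le> exp (2 * L * \<bar>t\<bar>)" for t
    using \<open>L > 0\<close> by simp
  have step: "norm (y t - z t) \<le> (d + C) * exp (2 * L * \<bar>t\<bar>)" if "0 \<le> C"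
    "\<And>t. norm (F (y t) - F (z t)) \<le> C * (2 * L) * exp (2 * L * \<bar>t\<bar>)" for C t
  proof -
    have "norm (y t - z t) \<le> d + norm ((y t - z t) - (y 0 - z 0))"
      unfolding d_def by (rule norm_triangle_sub)
    also have "\<dots> \<le> d + C * (exp (2 * L * \<bar>t\<bar>) - 1)"
      using norm_le_exp_of_derivative_le[OF deriv that(2)] by simp
    also have "\<dots> \<le> d * exp (2 * L * \<bar>t\<bar>) + C * exp (2 * L * \<bar>t\<bar>)"
      using mult_left_mono[OF E1[of t], of d] \<open>0 \<le> C\<close> by (simp add: d_def algebra_simps)
    finally show ?thesis by (simp add: algebra_simps)
  qed
  \<comment> \<open>The excess over the fixed point \<open>2 * d\<close> halves at each round;
    \<open>M / L + d\<close> is a convenient initial excess, above the crude bound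
    \<open>d + M / L\<close>.\<close>
  have est: "norm (y t - z t) \<le> (2 * d + (M / L + d) * (1/2)^n) * exp (2 * L * \<bar>t\<bar>)" for n t
  proof (induction n arbitrary: t)
    case 0
    have "norm (F (y t) - F (z t)) \<le> (M / L) * (2 * L) * exp (2 * L * \<bar>t\<bar>)" for t
    proof -
      have "norm (F (y t) - F (z t)) \<le> 2 * M"
        using norm_triangle_ineq4[of "F (y t)" "F (z t)"] bnd[of "y t"] bnd[of "z t"] by linarith
      also have "\<dots> \<le> 2 * M * exp (2 * L * \<bar>t\<bar>)"
        using mult_left_mono[OF E1[of t], of "2 * M"] M by simp
      finally show ?thesis using \<open>L > 0\<close> by simp
    qed
    from step[OF _ this, of t] M \<open>L > 0\<close> have "norm (y t - z t) \<le> (d + M / L) * exp (2 * L * \<bar>t\<bar>)"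
      by simp
    also have "\<dots> \<le> (2 * d + (M / L + d)) * exp (2 * L * \<bar>t\<bar>)"
      by (intro mult_right_mono) (auto simp: d_def)
    finally show ?case by simp
  next
    case (Suc n)
    let ?B = "2 * d + (M / L + d) * (1/2)^n"
    have "norm (F (y t) - F (z t)) \<le> (?B / 2) * (2 * L) * exp (2 * L * \<bar>t\<bar>)" for t
    proof -
      have "L * norm (y t - z t) \<le> L * (?B * exp (2 * L * \<bar>t\<bar>))"
        using Suc.IH \<open>L > 0\<close> by (intro mult_left_mono) auto
      with lip[of "y t" "z t"] have "norm (F (y t) - F (z t)) \<le> L * (?B * exp (2 * L * \<bar>t\<bar>))"
        by (rule order_trans)
      moreover have "(B / 2) * (2 * L) * e = L * (B * e)" for B e :: real
        by simp
      ultimately show ?thesis by (simp only:)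
    qed
    moreover have "0 \<le> ?B / 2"
      using M \<open>L > 0\<close> by (simp add: d_def)
    ultimately have "norm (y t - z t) \<le> (d + ?B / 2) * exp (2 * L * \<bar>t\<bar>)"
      using step by blast
    moreover have "d + (2 * d + K * r) / 2 = 2 * d + K * (1/2 * r)" for K r :: real
      by (simp add: field_simps)
    ultimately show ?case by (simp only: power_Suc)
  qed
  have "(\<lambda>n. (2 * d + (M / L + d) * (1/2)^n) * exp (2 * L * \<bar>t\<bar>))
      \<longlonglongrightarrow> (2 * d + (M / L + d) * 0) * exp (2 * L * \<bar>t\<bar>)"
    by (intro tendsto_intros LIMSEQ_power_zero) auto
  then have "norm (y t - z t) \<le> (2 * d + (M / L + d) * 0) * exp (2 * L * \<bar>t\<bar>)"
    by (rule LIMSEQ_le_const) (use est in blast)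
  then show ?thesis by (simp add: d_def mult_ac)
qed

text \<open>The solution is sought as \<open>x + exp (2 L \<bar>t\<bar>) u(t)\<close> with \<open>u\<close> bounded: in this weighted norm
  Picard's operator contracts by \<open>1/2\<close> on the whole time axis at once.\<close>

lemma ode_solution_exists:
  fixes F :: "'a::banach \<Rightarrow> 'a"
  assumes lip: "\<And>x y. norm (F x - F y) \<le> L * norm (x - y)" and "L > 0"
    and bnd: "\<And>x. norm (F x) \<le> M"
  obtains y where "y 0 = x" "\<And>t. (y has_vector_derivative F (y t)) (at t)"
proof -
  let ?e = "\<lambda>t::real. exp (2 * L * \<bar>t\<bar>)"
  have M: "0 \<le> M" using order_trans[OF norm_ge_zero bnd] .
  have E1: "1 \<le> ?e t" for t
    using \<open>L > 0\<close> by simp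
  have "continuous_on UNIV F"
    using lip \<open>L > 0\<close> by (intro lipschitz_on_continuous_on[of L] lipschitz_onI) (auto simp: dist_norm)
  then have cont: "continuous_on UNIV (\<lambda>t. F (x + ?e t *\<^sub>R apply_bcontfun u t))" for u :: "real \<Rightarrow>\<^sub>C 'a"
    by (rule continuous_on_compose2) (intro continuous_intros, auto)
  have "\<exists>h. (\<forall>t. (h has_vector_derivative F (x + ?e t *\<^sub>R apply_bcontfun u t)) (at t)) \<and> h 0 = 0" for u
    by (rule antiderivative_on_reals[OF cont[of u]]) blast
  \<comment> \<open>\<open>H u\<close> integrates the field along the path encoded by
    \<open>u\<close>; \<open>P\<close> divides the result by the weight, which returns it to the
    bounded functions.\<close>
  then obtain H where H: "\<And>u t. (H u has_vector_derivative F (x + ?e t *\<^sub>R apply_bcontfun u t)) (at t)"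
    and H0: "\<And>u. H u 0 = 0"
    by metis
  define P where "P u t = (1 / ?e t) *\<^sub>R H u t" for u t
  have scaled: "norm ((1 / ?e t) *\<^sub>R h) \<le> C" if "norm h \<le> C * (?e t - 1)" "0 \<le> C" for h :: 'a and t C
  proof -
    have "norm h \<le> C * ?e t" using that by (simp add: algebra_simps)
    then show ?thesis by (simp add: field_simps)
  qed
  have P: "P u \<in> bcontfun" for u
  proof (rule bcontfun_normI)
    have "continuous_on UNIV (H u)"
      using H by (meson continuous_at_imp_continuous_on has_vector_derivative_continuous)
    then show "continuous_on UNIV (P u)"
      unfolding P_def by (intro continuous_intros) auto
    have "norm (F (x + ?e t *\<^sub>R apply_bcontfun u t)) \<le> (M / (2 * L)) * (2 * L) * ?e t" for t
      using bnd[of "x + ?e t *\<^sub>R apply_bcontfun u t"] mult_left_mono[OF E1[of t] M] \<open>L > 0\<close> by simp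
    from norm_le_exp_of_derivative_le[OF H this]
    show "norm (P u t) \<le> M / (2 * L)" for t
      unfolding P_def using M \<open>L > 0\<close> by (intro scaled) (simp_all add: H0)
  qed
  have "dist (Bcontfun (P u)) (Bcontfun (P v)) \<le> 1/2 * dist u v" for u v
  proof (rule dist_bound)
    fix t
    have deriv: "((\<lambda>t. H u t - H v t) has_vector_derivative
      F (x + ?e t *\<^sub>R apply_bcontfun u t) - F (x + ?e t *\<^sub>R apply_bcontfun v t)) (at t)" for t
      by (intro has_vector_derivative_diff H)
    have "norm (F (x + ?e t *\<^sub>R apply_bcontfun u t) - F (x + ?e t *\<^sub>R apply_bcontfun v t))
      \<le> (1/2 * dist u v) * (2 * L) * ?e t" for t
    proof -
      let ?u = "apply_bcontfun u t" and ?v = "apply_bcontfun v t"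
      have eq: "(x + ?e t *\<^sub>R ?u) - (x + ?e t *\<^sub>R ?v) = ?e t *\<^sub>R (?u - ?v)"
        by (simp only: scaleR_diff_right add_diff_cancel_left)
      have "norm (F (x + ?e t *\<^sub>R ?u) - F (x + ?e t *\<^sub>R ?v))
        \<le> L * norm ((x + ?e t *\<^sub>R ?u) - (x + ?e t *\<^sub>R ?v))"
        by (rule lip)
      also have "\<dots> = L * (?e t * dist ?u ?v)"
        by (simp only: eq norm_scaleR abs_exp_cancel dist_norm)
      also have "\<dots> \<le> L * (?e t * dist u v)"
        using dist_bounded[of u t v] \<open>L > 0\<close> by (intro mult_left_mono) auto
      finally show ?thesis by (simp add: mult_ac)
    qed
    from norm_le_exp_of_derivative_le[OF deriv this, of t]
    have "norm (P u t - P v t) \<le> 1/2 * dist u v"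
      unfolding P_def scaleR_diff_right[symmetric] by (intro scaled) (simp_all add: H0)
    then show "dist (apply_bcontfun (Bcontfun (P u)) t) (apply_bcontfun (Bcontfun (P v)) t) \<le> 1/2 * dist u v"
      by (simp only: Bcontfun_inverse[OF P] dist_norm)
  qed
  \<comment> \<open>Multiplied by the weight, the fixed-point equation says that the path encoded by
    \<open>u\<close> is \<open>x + H u t\<close>, the very path along which \<open>H u\<close>
    integrates.\<close>
  then obtain u where "Bcontfun (P u) = u"
    using banach_fix_type[of "1/2" "\<lambda>u. Bcontfun (P u)"] by auto
  then have "P u = apply_bcontfun u"
    by (metis Bcontfun_inverse P)
  moreover have "?e t *\<^sub>R P u t = H u t" for t
    by (simp add: P_def)
  ultimately have u: "?e t *\<^sub>R apply_bcontfun u t = H u t" for t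
    by simp
  show thesis
  proof
    show "x + H u 0 = x" by (simp add: H0)
    show "((\<lambda>t. x + H u t) has_vector_derivative F (x + H u t)) (at t)" for t
      using has_vector_derivative_add[OF has_vector_derivative_const H[of u t], of x] by (simp add: u)
  qed
qed

text \<open>\<open>ode_solutions_dist\<close> serves twice: with equal initial values it is
  uniqueness, hence the group law; with different ones it makes each time map Lipschitz.\<close>

lemma lipschitz_flow:
  fixes F :: "'a::banach \<Rightarrow> 'a"
  assumes lip: "\<And>x y. norm (F x - F y) \<le> L * norm (x - y)" and "L > 0"
    and bnd: "\<And>x. norm (F x) \<le> M"
  obtains \<phi> :: "real \<Rightarrow> 'a \<Rightarrow> 'a" where
    "\<And>x. \<phi> 0 x = x" "\<And>s t x. \<phi> (s + t) x = \<phi> s (\<phi> t x)"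
    "\<And>t x. ((\<lambda>t. \<phi> t x) has_vector_derivative F (\<phi> t x)) (at t)"
    "\<And>t. continuous_on UNIV (\<phi> t)"
proof -
  have "\<forall>x. \<exists>y. y 0 = x \<and> (\<forall>t. (y has_vector_derivative F (y t)) (at t))"
    using ode_solution_exists[OF lip \<open>L > 0\<close> bnd] by metis
  then obtain y where y0: "\<And>x. y x 0 = x"
    and y: "\<And>x t. (y x has_vector_derivative F (y x t)) (at t)"
    by metis
  note dist = ode_solutions_dist[OF lip \<open>L > 0\<close> bnd]
  show thesis
  proof
    show "y x 0 = x" for x by (rule y0)
    show "((\<lambda>t. y x t) has_vector_derivative F (y x t)) (at t)" for x t by (rule y)
    show "y x (s + t) = y (y x t) s" for x s t
    proof -
      have "((\<lambda>s. y x (s + t)) has_vector_derivative F (y x (s + t))) (at s)" for s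
      proof -
        have "((\<lambda>s. s + t) has_vector_derivative 1) (at s)"
          by (auto intro!: derivative_eq_intros)
        from vector_diff_chain_at[OF this y] show ?thesis by (simp add: o_def)
      qed
      from dist[OF this y, of s "y x t"] show ?thesis by (simp add: y0)
    qed
    show "continuous_on UNIV (\<lambda>x. y x t)" for t
      using dist[OF y y, of _ t]
      by (intro lipschitz_on_continuous_on[of "2 * exp (2 * L * \<bar>t\<bar>)"] lipschitz_onI)
         (auto simp: dist_norm y0)
  qed
qed

section \<open>Orbits across the band and transport between levels\<close>

text \<open>If the level were never reached, \<open>f\<close> would converge along the path, and
  \<open>len\<close> would make the integer-time samples Cauchy. Their limit lies in the closed
  range of levels where \<open>S\<close> is positive, whereas \<open>slope\<close> forces
  \<open>S\<close> to be nonpositive there. No field appears in the statement, so that it also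
  applies to \<open>- f\<close> along a reversed orbit.\<close>

lemma ascending_path_reaches_level:
  fixes f S :: "'a::banach \<Rightarrow> real" and \<gamma> :: "real \<Rightarrow> 'a"
  assumes f: "continuous_on UNIV f" and S: "continuous_on UNIV S" and "0 < b"
    and deriv: "\<And>t. ((\<lambda>t. f (\<gamma> t)) has_real_derivative a t) (at t)"
    and slope: "\<And>t. b * S (\<gamma> t) \<le> a t"
    and len: "\<And>s t. s \<le> t \<Longrightarrow> b * norm (\<gamma> t - \<gamma> s) \<le> f (\<gamma> t) - f (\<gamma> s)"
    and pos: "\<And>y. \<lbrakk>lo \<le> f y; f y \<le> l\<rbrakk> \<Longrightarrow> 0 < S y"
    and "lo \<le> f (\<gamma> 0)"
  shows "\<exists>t. l \<le> f (\<gamma> t)"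
proof (rule ccontr)
  assume "\<not> ?thesis"
  then have below: "f (\<gamma> t) < l" for t by (meson not_le)
  have mono: "f (\<gamma> s) \<le> f (\<gamma> t)" if "s \<le> t" for s t
    using len[OF that] \<open>0 < b\<close> by (smt (verit) mult_nonneg_nonneg norm_ge_zero)
  define v where "v n = f (\<gamma> (real n))" for n :: nat
  have "incseq v" by (auto simp: incseq_def v_def intro: mono)
  moreover have "v n \<le> l" for n using below[of "real n"] by (simp add: v_def)
  ultimately obtain L where L: "v \<longlonglongrightarrow> L"
    using incseq_convergent by blast
  have norm_le: "norm (\<gamma> (real m) - \<gamma> (real n)) * b \<le> dist (v m) (v n)" for m n
    using len[of "real m" "real n"] len[of "real n" "real m"]
    by (cases "m \<le> n") (auto simp: v_def dist_real_def norm_minus_commute mult_ac)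
  have "Cauchy (\<lambda>n. \<gamma> (real n))"
  proof (rule metric_CauchyI)
    fix e :: real assume "0 < e"
    then obtain M where "\<And>m n. m \<ge> M \<Longrightarrow> n \<ge> M \<Longrightarrow> dist (v m) (v n) < e * b"
      using metric_CauchyD[OF LIMSEQ_imp_Cauchy[OF L], of "e * b"] \<open>0 < b\<close> by auto
    then have "norm (\<gamma> (real m) - \<gamma> (real n)) * b < e * b" if "m \<ge> M" "n \<ge> M" for m n
      using order.strict_trans1[OF norm_le] that by blast
    then have "dist (\<gamma> (real m)) (\<gamma> (real n)) < e" if "m \<ge> M" "n \<ge> M" for m n
      using that \<open>0 < b\<close> by (simp add: dist_norm)
    then show "\<exists>M. \<forall>m\<ge>M. \<forall>n\<ge>M. dist (\<gamma> (real m)) (\<gamma> (real n)) < e" by blast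
  qed
  then obtain y where y: "(\<lambda>n. \<gamma> (real n)) \<longlonglongrightarrow> y"
    using Cauchy_convergent convergent_def by blast
  have lim: "(\<lambda>n. g (z n)) \<longlonglongrightarrow> g y" if "continuous_on UNIV g" "z \<longlonglongrightarrow> y"
    for g :: "'a \<Rightarrow> real" and z
    using continuous_on_tendsto_compose[OF that] by simp
  have "v \<longlonglongrightarrow> f y" unfolding v_def by (rule lim[OF f y])
  moreover have "lo \<le> v n" for n
    using \<open>lo \<le> f (\<gamma> 0)\<close> mono[of 0 "real n"] by (simp add: v_def)
  ultimately have "lo \<le> f y" "f y \<le> l"
    using \<open>\<And>n. v n \<le> l\<close> by (auto intro: LIMSEQ_le_const LIMSEQ_le_const2)
  then have "0 < S y" by (rule pos)
  \<comment> \<open>The mean value theorem turns the vanishing increments of \<open>f\<close> into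
    times at which the slope itself tends to 0.\<close>
  have "\<exists>\<xi>. real n < \<xi> \<and> \<xi> < real n + 1 \<and> v (Suc n) - v n = a \<xi>" for n
    using MVT2[of "real n" "real n + 1" "\<lambda>t. f (\<gamma> t)" a] deriv
    by (auto simp: v_def add.commute)
  then obtain \<xi> where \<xi>: "\<And>n. real n < \<xi> n" "\<And>n. \<xi> n < real n + 1" "\<And>n. v (Suc n) - v n = a (\<xi> n)"
    by metis
  have incr: "(\<lambda>n. v (Suc n) - v n) \<longlonglongrightarrow> 0"
    using tendsto_diff[OF LIMSEQ_Suc[OF L] L] by simp
  \<comment> \<open>Between consecutive integer times the displacement is at most the increment of
    \<open>f\<close> over \<open>b\<close>, so the intermediate points have the same limit
    \<open>y\<close>.\<close>
  have "(\<lambda>n. \<gamma> (\<xi> n) - \<gamma> (real n)) \<longlonglongrightarrow> 0"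
  proof (rule Lim_null_comparison)
    show "\<forall>\<^sub>F n in sequentially. norm (\<gamma> (\<xi> n) - \<gamma> (real n)) \<le> (v (Suc n) - v n) / b"
    proof (intro always_eventually allI)
      fix n
      have "b * norm (\<gamma> (\<xi> n) - \<gamma> (real n)) \<le> f (\<gamma> (\<xi> n)) - f (\<gamma> (real n))"
        using \<xi>(1)[of n] by (intro len) simp
      also have "\<dots> \<le> v (Suc n) - v n"
        using \<xi>(2)[of n] mono[of "\<xi> n" "real (Suc n)"] by (simp add: v_def)
      finally show "norm (\<gamma> (\<xi> n) - \<gamma> (real n)) \<le> (v (Suc n) - v n) / b"
        using \<open>0 < b\<close> by (simp add: field_simps)
    qed
    show "(\<lambda>n. (v (Suc n) - v n) / b) \<longlonglongrightarrow> 0"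
      using tendsto_divide[OF incr tendsto_const, of b] \<open>0 < b\<close> by simp
  qed
  from tendsto_add[OF this y] have "(\<lambda>n. \<gamma> (\<xi> n)) \<longlonglongrightarrow> y" by simp
  then have "(\<lambda>n. b * S (\<gamma> (\<xi> n))) \<longlonglongrightarrow> b * S y"
    by (intro tendsto_mult_left lim[OF S])
  moreover have "b * S (\<gamma> (\<xi> n)) \<le> v (Suc n) - v n" for n
    using slope[of "\<xi> n"] \<xi>(3)[of n] by simp
  ultimately have "b * S y \<le> 0"
    using incr by (intro LIMSEQ_le) auto
  with \<open>0 < S y\<close> \<open>0 < b\<close> show False
    by (simp add: mult_le_0_iff)
qed

text \<open>The point of the orbit of \<open>x\<close> at level \<open>l\<close> is unique, since along an orbit \<open>b\<close> times the distance
  travelled is at most the variation of \<open>f\<close>. The same estimate yields the joint continuity in \<open>(x, l)\<close>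
  without any continuity of the hitting time.\<close>

lemma level_transport_exists:
  fixes f :: "'a::banach \<Rightarrow> real"
  assumes C1: "C1_functional f" and "0 < b"
    and band: "\<And>x. f x \<in> {lo..hi} \<Longrightarrow> b < norm (dual_derivative f x)"
  obtains P :: "'a \<Rightarrow> real \<Rightarrow> 'a" where
    "\<And>x l. \<lbrakk>f x \<in> {lo..hi}; l \<in> {lo..hi}\<rbrakk> \<Longrightarrow> f (P x l) = l"
    "\<And>x. f x \<in> {lo..hi} \<Longrightarrow> P x (f x) = x"
    "\<And>x l l'. \<lbrakk>f x \<in> {lo..hi}; l \<in> {lo..hi}; l' \<in> {lo..hi}\<rbrakk> \<Longrightarrow> P (P x l) l' = P x l'"
    "continuous_on (f -` {lo..hi} \<times> {lo..hi}) (\<lambda>(x, l). P x l)"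
proof -
  have f': "(f has_derivative dual_derivative f x) (at x)" for x
    using C1 by (simp add: C1_functional_def has_derivative_dual_derivative)
  then have fc: "continuous_on UNIV f"
    by (meson continuous_at_imp_continuous_on has_derivative_continuous)
  have "continuous_on UNIV (dual_derivative f)"
    using C1 by (simp add: C1_functional_def)
  then obtain N S where N_lip: "\<And>x y. norm (N x - N y) \<le> 4 * norm (x - y)"
    and NS: "\<And>x. norm (N x) \<le> S x" and S2: "\<And>x. S x \<le> 2" and Sc: "continuous_on UNIV S"
    and slope: "\<And>x. b * S x \<le> dual_derivative f x (N x)"
    and Spos: "\<And>x. x \<in> f -` {lo..hi} \<Longrightarrow> 0 < S x"
    using lipschitz_pseudo_gradient[of "dual_derivative f" b "f -` {lo..hi}"] band \<open>0 < b\<close>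
    by (metis less_imp_le vimage_eq)
  obtain \<phi> :: "real \<Rightarrow> 'a \<Rightarrow> 'a" where \<phi>0: "\<And>x. \<phi> 0 x = x"
    and \<phi>add: "\<And>s t x. \<phi> (s + t) x = \<phi> s (\<phi> t x)"
    and \<phi>': "\<And>t x. ((\<lambda>t. \<phi> t x) has_vector_derivative N (\<phi> t x)) (at t)"
    and \<phi>c: "\<And>t. continuous_on UNIV (\<phi> t)"
    using lipschitz_flow[OF N_lip _ order_trans[OF NS S2]] by (metis zero_less_numeral)
  have f\<phi>': "((\<lambda>t. f (\<phi> t x)) has_real_derivative dual_derivative f (\<phi> t x) (N (\<phi> t x))) (at t)" for t x
    using vector_derivative_diff_chain_within[OF \<phi>'[of x t] has_derivative_at_withinI[OF f']]
    by (simp add: o_def has_real_derivative_iff_has_vector_derivative)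
  \<comment> \<open>The mean value inequality with \<open>f / b\<close> along the orbit as majorant
    of the curve.\<close>
  have len: "b * norm (\<phi> t x - \<phi> s x) \<le> f (\<phi> t x) - f (\<phi> s x)" if "s \<le> t" for s t x
  proof (cases "s = t")
    case False
    have "norm (\<phi> t x - \<phi> s x) \<le> f (\<phi> t x) / b - f (\<phi> s x) / b"
    proof (rule differentiable_bound_general)
      show "s < t" using that False by simp
      show "continuous_on {s..t} (\<lambda>t. \<phi> t x)"
        using \<phi>' by (meson continuous_at_imp_continuous_on has_vector_derivative_continuous)
      show deriv: "((\<lambda>t. f (\<phi> t x) / b) has_vector_derivative dual_derivative f (\<phi> u x) (N (\<phi> u x)) / b) (at u)" for u
        using DERIV_cdivide[OF f\<phi>'] by (simp add: has_real_derivative_iff_has_vector_derivative)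
      show "continuous_on {s..t} (\<lambda>t. f (\<phi> t x) / b)"
        using deriv by (meson continuous_at_imp_continuous_on has_vector_derivative_continuous)
      show "norm (N (\<phi> u x)) \<le> dual_derivative f (\<phi> u x) (N (\<phi> u x)) / b" for u
      proof -
        have "b * norm (N (\<phi> u x)) \<le> b * S (\<phi> u x)"
          using NS \<open>0 < b\<close> by simp
        also note slope
        finally show ?thesis using \<open>0 < b\<close> by (simp add: field_simps)
      qed
    qed (rule \<phi>')
    then show ?thesis using \<open>0 < b\<close> by (simp add: field_simps)
  qed simp
  have dist_le: "norm (\<phi> t x - \<phi> s x) \<le> \<bar>f (\<phi> t x) - f (\<phi> s x)\<bar> / b" for s t x
    using len[of s t x] len[of t s x] \<open>0 < b\<close>
    by (cases "s \<le> t") (auto simp: field_simps norm_minus_commute)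
  have hit: "\<exists>t. f (\<phi> t x) = l" if x: "f x \<in> {lo..hi}" and l: "l \<in> {lo..hi}" for x l
  proof -
    obtain t1 where t1: "l \<le> f (\<phi> t1 x)"
      using ascending_path_reaches_level[OF fc Sc \<open>0 < b\<close> f\<phi>' slope len, of lo l] Spos x l
      by (auto simp: \<phi>0)
    \<comment> \<open>Descent to \<open>l\<close> is ascent of \<open>- f\<close> in reversed time;
      the lower end of the range of levels becomes \<open>- hi\<close>.\<close>
    have "\<exists>t. - l \<le> - f (\<phi> (- t) x)"
    proof (rule ascending_path_reaches_level[where S = S and lo = "- hi" and b = b])
      show "((\<lambda>t. - f (\<phi> (- t) x)) has_real_derivative
        dual_derivative f (\<phi> (- t) x) (N (\<phi> (- t) x))) (at t)" for t
        using DERIV_minus[OF DERIV_mirror[THEN iffD1, OF f\<phi>'[of x "- t"]]] by simp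
      show "b * norm (\<phi> (- t) x - \<phi> (- s) x) \<le> - f (\<phi> (- t) x) - - f (\<phi> (- s) x)" if "s \<le> t" for s t
        using len[of "- t" "- s" x] that by (simp add: norm_minus_commute)
      show "- hi \<le> - f (\<phi> (- 0) x)" using x by (simp add: \<phi>0)
      show "0 < S y" if "- hi \<le> - f y" "- f y \<le> - l" for y
        using that l by (intro Spos) auto
    qed (use Sc \<open>0 < b\<close> slope in \<open>auto intro!: continuous_intros fc\<close>)
    then obtain t2 where t2: "f (\<phi> t2 x) \<le> l" by auto
    have "isCont (\<lambda>t. f (\<phi> t x)) t" for t
      using f\<phi>' DERIV_isCont by blast
    then have cont: "continuous_on A (\<lambda>t. f (\<phi> t x))" for A
      by (simp add: continuous_at_imp_continuous_on)
    show ?thesis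
    proof (cases "t2 \<le> t1")
      case True
      then show ?thesis using IVT'[OF t2 t1 _ cont] by auto
    next
      case False
      then show ?thesis using IVT2'[OF t2 t1 _ cont] by auto
    qed
  qed
  define P where "P x l = \<phi> (SOME t. f (\<phi> t x) = l) x" for x l
  \<comment> \<open>The chosen time does not matter: by \<open>dist_le\<close>, two points of an
    orbit at equal level coincide.\<close>
  have P: "P x l = \<phi> t x" if "f (\<phi> t x) = l" for x l t
  proof -
    define s where "s = (SOME t. f (\<phi> t x) = l)"
    have "f (\<phi> s x) = l" unfolding s_def using that by (rule someI)
    then show ?thesis
      using dist_le[of s x t] that by (simp add: P_def s_def)
  qed
  show thesis
  proof
    show "f (P x l) = l" if "f x \<in> {lo..hi}" "l \<in> {lo..hi}" for x l
      using hit[OF that] P by auto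
    show "P x (f x) = x" for x
      using P[of 0 x] by (simp add: \<phi>0)
    show "P (P x l) l' = P x l'"
      if "f x \<in> {lo..hi}" "l \<in> {lo..hi}" "l' \<in> {lo..hi}" for x l l'
    proof -
      obtain t t' where t: "f (\<phi> t x) = l" "f (\<phi> t' x) = l'"
        using hit[OF \<open>f x \<in> _\<close> \<open>l \<in> _\<close>] hit[OF \<open>f x \<in> _\<close> \<open>l' \<in> _\<close>] by blast
      have "\<phi> (t' - t) (\<phi> t x) = \<phi> t' x"
        by (simp flip: \<phi>add)
      then show ?thesis using P t by metis
    qed
    show "continuous_on (f -` {lo..hi} \<times> {lo..hi}) (\<lambda>(x, l). P x l)"
      unfolding continuous_on_def
    proof
      fix z assume "z \<in> f -` {lo..hi} \<times> {lo..hi}"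
      then obtain x0 l0 where z: "z = (x0, l0)" and x0: "f x0 \<in> {lo..hi}" and l0: "l0 \<in> {lo..hi}"
        by auto
      let ?F = "at (x0, l0) within f -` {lo..hi} \<times> {lo..hi}"
      obtain t0 where t0: "f (\<phi> t0 x0) = l0" using hit[OF x0 l0] by blast
      \<comment> \<open>The time \<open>t0\<close> is frozen. The first term pays for moving along
        the orbit of \<open>x\<close> from \<open>\<phi> t0 x\<close> to level \<open>l\<close>, the
        second is continuity of the single map \<open>\<phi> t0\<close>.\<close>
      define g where "g = (\<lambda>(x, l). \<bar>l - f (\<phi> t0 x)\<bar> / b + norm (\<phi> t0 x - \<phi> t0 x0))"
      have "continuous_on UNIV g"
        unfolding g_def case_prod_beta
        by (intro continuous_intros continuous_on_compose2[OF fc] continuous_on_compose2[OF \<phi>c])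
          (use \<open>0 < b\<close> in auto)
      then have "(g \<longlongrightarrow> g (x0, l0)) ?F"
        by (meson UNIV_I continuous_on_def tendsto_within_subset subset_UNIV)
      then have lim: "(g \<longlongrightarrow> 0) ?F"
        by (simp add: g_def t0)
      have "norm (P x l - P x0 l0) \<le> g (x, l)" if "f x \<in> {lo..hi}" "l \<in> {lo..hi}" for x l
      proof -
        obtain t where t: "f (\<phi> t x) = l" using hit \<open>f x \<in> _\<close> \<open>l \<in> _\<close> by blast
        have "norm (\<phi> t x - \<phi> t0 x0) \<le> norm (\<phi> t x - \<phi> t0 x) + norm (\<phi> t0 x - \<phi> t0 x0)"
          using norm_triangle_ineq[of "\<phi> t x - \<phi> t0 x" "\<phi> t0 x - \<phi> t0 x0"] by simp
        then show ?thesis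
          using dist_le[of t x t0] by (simp add: g_def P[OF t] P[OF t0] t)
      qed
      then have "\<forall>\<^sub>F z in ?F. norm ((case z of (x, l) \<Rightarrow> P x l) - P x0 l0) \<le> g z"
        by (auto simp: eventually_at_filter intro!: always_eventually)
      from Lim_null_comparison[OF this lim]
      have "((\<lambda>(x, l). P x l) \<longlongrightarrow> P x0 l0) ?F"
        by (rule LIM_zero_cancel)
      then show "((\<lambda>(x, l). P x l) \<longlongrightarrow> (case z of (x, l) \<Rightarrow> P x l))
        (at z within f -` {lo..hi} \<times> {lo..hi})"
        by (simp add: z)
    qed
  qed
qed

section \<open>From level changes to the homeomorphism of the space\<close>

text \<open>By the transport law, applying \<open>w h\<close> and then \<open>w h'\<close> changes
  levels by the composition of \<open>h\<close> and \<open>h'\<close>, so inverse level changes give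
  inverse maps. Continuity is obtained by gluing, as fixed endpoints make the transport trivial on
  the boundary levels.\<close>

lemma homeomorphism_of_level_transport:
  fixes f :: "'a::topological_space \<Rightarrow> real" and P :: "'a \<Rightarrow> real \<Rightarrow> 'a"
  assumes f: "continuous_on UNIV f"
    and fP: "\<And>x l. \<lbrakk>f x \<in> {lo..hi}; l \<in> {lo..hi}\<rbrakk> \<Longrightarrow> f (P x l) = l"
    and P_id: "\<And>x. f x \<in> {lo..hi} \<Longrightarrow> P x (f x) = x"
    and PP: "\<And>x l l'. \<lbrakk>f x \<in> {lo..hi}; l \<in> {lo..hi}; l' \<in> {lo..hi}\<rbrakk> \<Longrightarrow> P (P x l) l' = P x l'"
    and P_cont: "continuous_on (f -` {lo..hi} \<times> {lo..hi}) (\<lambda>(x, l). P x l)"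
    and h: "homeomorphism {lo..hi} {lo..hi} h h'" "h lo = lo" "h hi = hi" and "lo \<le> hi"
  defines "w \<equiv> \<lambda>h x. if f x \<in> {lo..hi} then P x (h (f x)) else x"
  shows "homeomorphism UNIV UNIV (w h) (w h')"
proof -
  have cont: "continuous_on UNIV (w k)"
    if k: "continuous_on {lo..hi} k" "k ` {lo..hi} \<subseteq> {lo..hi}" "k lo = lo" "k hi = hi" for k
  proof -
    \<comment> \<open>\<open>?B\<close> includes the levels \<open>lo\<close> and \<open>hi\<close>:
      gluing needs two closed sets, and on their overlap both formulas give
      \<open>x\<close>.\<close>
    let ?A = "f -` {lo..hi}" and ?B = "f -` ({..lo} \<union> {hi..})"
    have "closed ?A" "closed ?B"
      by (intro closed_vimage[OF _ f] closed_Un closed_atMost closed_atLeast closed_atLeastAtMost)+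
    moreover have "continuous_on ?A (\<lambda>x. P x (k (f x)))"
    proof -
      have "continuous_on ?A (\<lambda>x. k (f x))"
        by (rule continuous_on_compose2[OF k(1) continuous_on_subset[OF f]]) auto
      then have "continuous_on ?A (\<lambda>x. (x, k (f x)))"
        by (intro continuous_on_Pair continuous_on_id)
      from continuous_on_compose2[OF P_cont this] k(2) show ?thesis by auto
    qed
    moreover have "P x (k (f x)) = x" if "f x \<in> {lo..hi}" "x \<in> ?B" for x
    proof -
      have "f x = lo \<or> f x = hi" using that by auto
      then show ?thesis using P_id[of x] k(3,4) that(1) by auto
    qed
    ultimately have "continuous_on (?A \<union> ?B) (w k)"
      unfolding w_def by (intro continuous_on_cases continuous_on_id) auto
    moreover have "?A \<union> ?B = UNIV" by auto
    ultimately show ?thesis by simp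
  qed
  have inv: "w k' (w k x) = x"
    if "k ` {lo..hi} \<subseteq> {lo..hi}" "\<And>l. l \<in> {lo..hi} \<Longrightarrow> k' (k l) = l" for k k' x
  proof (cases "f x \<in> {lo..hi}")
    case True
    then have "k (f x) \<in> {lo..hi}" using that(1) by blast
    then show ?thesis
      using True that(2)[OF True] by (simp only: w_def fP PP P_id if_True)
  next
    case False
    then have "w k x = x" for k by (simp only: w_def if_False)
    then show ?thesis by simp
  qed
  have h': "h' lo = lo" "h' hi = hi"
    using homeomorphism_apply1[OF h(1), of lo] homeomorphism_apply1[OF h(1), of hi] h(2,3) \<open>lo \<le> hi\<close>
    by simp_all
  have im: "h ` {lo..hi} = {lo..hi}" "h' ` {lo..hi} = {lo..hi}"
    using h(1) by (auto simp: homeomorphism_def)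
  show ?thesis
  proof (rule homeomorphismI)
    show "continuous_on UNIV (w h)" "continuous_on UNIV (w h')"
      using h h' im homeomorphism_cont1[OF h(1)] homeomorphism_cont2[OF h(1)]
      by (intro cont; simp)+
    show "w h' (w h x) = x" "w h (w h' x) = x" for x
      using im homeomorphism_apply1[OF h(1)] homeomorphism_apply2[OF h(1)] by (intro inv; simp)+
  qed auto
qed

text \<open>It suffices to lower the single point \<open>p\<close> below \<open>r\<close>: an
  injective continuous map that fixes \<open>lo\<close> cannot rise to \<open>r\<close> before
  \<open>p\<close> and come back. The point is moved by a homeomorphism that carries one interval
  into another.\<close>

lemma interval_homeomorphism_lowering:
  fixes lo hi p r :: real
  assumes "lo < p" "p < hi" "lo < r" "r < hi"
  shows "\<exists>h h'. homeomorphism {lo..hi} {lo..hi} h h' \<and> h lo = lo \<and> h hi = hi \<and> (\<forall>s\<in>{lo..p}. h s < r)"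
proof -
  \<comment> \<open>\<open>p\<close> is thickened to \<open>{p..p'}\<close> and its target to
    \<open>{u..v}\<close> because the grouping result asks for boxes with nonempty interior; any
    choice with \<open>p < p' < hi\<close> and \<open>lo < u < v < r\<close> would do.\<close>
  define p' u v where "p' = (p + hi) / 2" and "u = (3 * lo + r) / 4" and "v = (lo + r) / 2"
  have bounds: "p < p'" "p' < hi" "lo < u" "u < v" "v < r"
    using assms by (auto simp: p'_def u_def v_def field_simps)
  then have boxes: "cbox p p' \<subseteq> box lo hi" "cbox u v \<subseteq> box lo hi" "box p p' \<noteq> {}" "box u v \<noteq> {}"
    using assms by (auto simp: subset_box box_real)
  have "\<exists>h h'. homeomorphism {lo..hi} {lo..hi} h h' \<and> h lo = lo \<and> h hi = hi \<and>
    (\<forall>x\<in>{p..p'}. h x \<in> {u..v})"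
  proof (rule homeomorphism_grouping_point_3[OF boxes])
    fix h h' :: "real \<Rightarrow> real"
    assume "homeomorphism (cbox lo hi) (cbox lo hi) h h'" "h lo = lo" "h hi = hi"
      and "\<And>x. x \<in> cbox p p' \<Longrightarrow> h x \<in> cbox u v"
    then show ?thesis
      by (intro exI[of _ h] exI[of _ h']) (simp add: cbox_interval)
  qed
  then obtain h h' where h: "homeomorphism {lo..hi} {lo..hi} h h'" "h lo = lo" "h hi = hi"
    and hp: "\<forall>x\<in>{p..p'}. h x \<in> {u..v}"
    by blast
  have "h p \<in> {u..v}" using bounds hp by auto
  then have "lo < h p" "h p < r" using bounds by auto
  have lower: "h s < r" if "lo \<le> s" "s \<le> p" for s
  proof (rule ccontr)
    assume "\<not> h s < r"
    \<comment> \<open>The value \<open>h p\<close> lies between \<open>h lo\<close> and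
      \<open>h s\<close>, so it is already taken somewhere in \<open>{lo..s}\<close>, against
      injectivity.\<close>
    then have "h lo \<le> h p" "h p \<le> h s" "s \<noteq> p"
      using \<open>lo < h p\<close> \<open>h p < r\<close> h(2) by auto
    have "continuous_on {lo..s} h"
      by (rule continuous_on_subset[OF homeomorphism_cont1[OF h(1)]]) (use that assms in auto)
    from IVT'[OF \<open>h lo \<le> h p\<close> \<open>h p \<le> h s\<close> \<open>lo \<le> s\<close> this]
    obtain s' where s': "lo \<le> s'" "s' \<le> s" "h s' = h p"
      by blast
    have "h' (h s') = s'"
      by (rule homeomorphism_apply1[OF h(1)]) (use s' that assms in auto)
    moreover have "h' (h p) = p"
      by (rule homeomorphism_apply1[OF h(1)]) (use assms in auto)
    ultimately have "s' = p" using s'(3) by metis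
    with s' that \<open>s \<noteq> p\<close> show False by simp
  qed
  with h show ?thesis
    by (intro exI[of _ h] exI[of _ h']) simp
qed

theorem lemma2p3:
  fixes D :: "'r set"
    and X :: "'r \<Rightarrow> 'a::banach set"
    and \<pi> :: "'r \<Rightarrow> 'a \<Rightarrow> 'a"
    and f :: "'a \<Rightarrow> real"
    and b c \<epsilon> :: real
  assumes "\<And>\<rho>. \<rho> \<in> D \<Longrightarrow> subspace (X \<rho>)"
    and "\<And>\<rho>. \<rho> \<in> D \<Longrightarrow> closed (X \<rho>)"
    and "\<And>\<rho>. \<rho> \<in> D \<Longrightarrow> linear (\<pi> \<rho>)"
    and "\<And>\<rho>. \<rho> \<in> D \<Longrightarrow> range (\<pi> \<rho>) = X \<rho>"
    and "closure (span (\<Union>\<rho>\<in>D. X \<rho>)) = UNIV"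
    and "C1_functional f"
    and "generalized_PS D \<pi> f"
    and "generalized_critical_points_at D \<pi> f c = {}"
    and "b > 0"
    and "\<epsilon> > 0"
    and "\<And>x. x \<in> level_band f c \<epsilon> \<Longrightarrow> norm (dual_derivative f x) > b"
  shows "\<forall>q\<in>{0<..<\<epsilon>}. \<exists>w w'. homeomorphism UNIV UNIV w w' \<and>
           (\<forall>x\<in>UNIV - level_band f c \<epsilon>. w x = x) \<and>
           w ` (f -` {..c + q}) \<subseteq> f -` {..<c - q}"
proof
  fix q assume q: "q \<in> {0<..<\<epsilon>}"
  let ?I = "{c - \<epsilon>..c + \<epsilon>}"
  have f: "continuous_on UNIV f"
    using \<open>C1_functional f\<close> unfolding C1_functional_def
    by (meson continuous_at_imp_continuous_on differentiable_imp_continuous_within)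
  obtain h h' where h: "homeomorphism ?I ?I h h'" "h (c - \<epsilon>) = c - \<epsilon>" "h (c + \<epsilon>) = c + \<epsilon>"
    and lower: "\<forall>s\<in>{c - \<epsilon>..c + q}. h s < c - q"
    using interval_homeomorphism_lowering[of "c - \<epsilon>" "c + q" "c + \<epsilon>" "c - q"] q by auto
  show "\<exists>w w'. homeomorphism UNIV UNIV w w' \<and>
           (\<forall>x\<in>UNIV - level_band f c \<epsilon>. w x = x) \<and>
           w ` (f -` {..c + q}) \<subseteq> f -` {..<c - q}"
  proof (rule level_transport_exists[of f b "c - \<epsilon>" "c + \<epsilon>", OF \<open>C1_functional f\<close> \<open>b > 0\<close>])
    show "b < norm (dual_derivative f x)" if "f x \<in> ?I" for x
      using that assms(11) by (simp add: level_band_def)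
    fix P assume P: "\<And>x l. \<lbrakk>f x \<in> ?I; l \<in> ?I\<rbrakk> \<Longrightarrow> f (P x l) = l"
      "\<And>x. f x \<in> ?I \<Longrightarrow> P x (f x) = x"
      "\<And>x l l'. \<lbrakk>f x \<in> ?I; l \<in> ?I; l' \<in> ?I\<rbrakk> \<Longrightarrow> P (P x l) l' = P x l'"
      "continuous_on (f -` ?I \<times> ?I) (\<lambda>(x, l). P x l)"
    define w where "w = (\<lambda>k x. if f x \<in> ?I then P x (k (f x)) else x)"
    have "c - \<epsilon> \<le> c + \<epsilon>"
      using \<open>\<epsilon> > 0\<close> by linarith
    then have "homeomorphism UNIV UNIV (w h) (w h')"
      unfolding w_def by (intro homeomorphism_of_level_transport[OF f P h])
    moreover have "w h x = x" if "x \<in> UNIV - level_band f c \<epsilon>" for x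
      using that by (auto simp: w_def level_band_def)
    \<comment> \<open>Since \<open>q < \<epsilon>\<close>, such a point outside the band lies below
      it, where \<open>w h\<close> is the identity and \<open>f x < c - \<epsilon> < c - q\<close>
      holds already.\<close>
    moreover have "f (w h x) < c - q" if "f x \<le> c + q" for x
    proof (cases "f x \<in> ?I")
      case True
      then have "h (f x) \<in> ?I" using h(1) by (auto simp: homeomorphism_def)
      then show ?thesis using True that lower by (simp add: w_def P(1))
    next
      case False
      with that q show ?thesis by (auto simp: w_def)
    qed
    ultimately show ?thesis
      by (intro exI[of _ "w h"] exI[of _ "w h'"]) auto
  qed
qed

end
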